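(* Let $\omega:[0,1]\to\mathbb{R}_+$ be a modulus of continuity. Suppose that for each $0<\alpha<1$ there exists $0<a(\alpha)<1$ such that the function $\frac{\omega(x)}{x^\alpha}$ is increasing on $(0,a(\alpha)]$, and suppose that $$\lim_{x\to0}\frac{\omega(x)}{x\cdot\log\left(\frac{e}{x}\right)}=0.$$ Then there exist a diffeomorphism $f\in\mathrm{Diff}^{\omega}_0[0,1]$ with $\gamma(f)=1$ and a constant $c(f)>0$ such that for any $\varepsilon>0$, $$\log\Gamma_n(f)\ge(1-\varepsilon)\cdot\log\frac{n}{\omega^{-1}\left(\frac{c(f)}{n}\right)}$$ for all sufficiently large $n$ (how large may depend on $\varepsilon$). Here $\omega^{-1}$ denotes the inverse function of $\omega$ (well defined for sufficiently small positive arguments).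
   Context: $\mathrm{Diff}_0[0,1]$ is the group of all $C^1$-smooth diffeomorphisms of $[0,1]$ fixing the end points $0$ and $1$. For $f\in\mathrm{Diff}_0[0,1]$ and $n\in\mathbb{N}$, the growth sequence is $\Gamma_n(f)=\max\{\|(f^n)'\|_\infty,\|(f^{-n})'\|_\infty\}$, where $f^n$ is the $n$-th iterate and $\|\cdot\|_\infty$ is the uniform norm on $[0,1]$; and $\gamma(f)=\lim_{n\to\infty}\sqrt[n]{\Gamma_n(f)}$ (the limit exists by submultiplicativity). A modulus of continuity is a non-decreasing continuous function $\omega:[0,1]\to\mathbb{R}_+=[0,\infty)$ with $\omega(0)=0$ and $\omega(\delta_1+\delta_2)\le\omega(\delta_1)+\omega(\delta_2)$ whenever $\delta_1,\delta_2,\delta_1+\delta_2\in[0,1]$. For a modulus of continuity $\omega$, $\mathrm{Diff}^{\omega}_0[0,1]$ is the set of $f\in\mathrm{Diff}_0[0,1]$ for which there is a constant $K(f)$ with $\omega_{f'}(\delta)\le K(f)\,\omega(\delta)$ for all $\delta\in[0,1]$, where $\omega_{f'}(\delta)=\max_{|x-y|\le\delta}|f'(x)-f'(y)|$. "Increasing" means strictly increasing, so that $\omega$ is positive and strictly increasing on some interval $(0,a]$. *)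

theory Defs
  imports "HOL-Analysis.Analysis"
begin

text \<open>
  Self-maps of \<open>[0,1]\<close> are represented by functions of type \<open>real \<Rightarrow> real\<close>; only their restriction
  to \<open>{0..1}\<close> matters. In particular derivatives are taken within \<open>{0..1}\<close>, hence are
  one-sided at the end points.
\<close>

definition deriv01 :: "(real \<Rightarrow> real) \<Rightarrow> real \<Rightarrow> real" where
  "deriv01 f x = vector_derivative f (at x within {0..1})"

definition C1_on01 :: "(real \<Rightarrow> real) \<Rightarrow> bool" where
  "C1_on01 f \<longleftrightarrow> f differentiable_on {0..1} \<and> continuous_on {0..1} (deriv01 f)"

definition inv01 :: "(real \<Rightarrow> real) \<Rightarrow> real \<Rightarrow> real" where
  "inv01 f = the_inv_into {0..1} f"

definition Diff0 :: "(real \<Rightarrow> real) set" where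
  "Diff0 = {f. bij_betw f {0..1} {0..1} \<and> f 0 = 0 \<and> f 1 = 1 \<and> C1_on01 f \<and> C1_on01 (inv01 f)}"

definition unif_norm :: "(real \<Rightarrow> real) \<Rightarrow> real" where
  "unif_norm g = (SUP x\<in>{0..1}. \<bar>g x\<bar>)"

definition growth_seq :: "nat \<Rightarrow> (real \<Rightarrow> real) \<Rightarrow> real" where
  "growth_seq n f = max (unif_norm (deriv01 (f ^^ n))) (unif_norm (deriv01 (inv01 f ^^ n)))"

definition growth_rate :: "(real \<Rightarrow> real) \<Rightarrow> real" where
  "growth_rate f = lim (\<lambda>n. root n (growth_seq n f))"

definition modulus_of_continuity :: "(real \<Rightarrow> real) \<Rightarrow> bool" where
  "modulus_of_continuity \<omega> \<longleftrightarrow>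
     (\<forall>x\<in>{0..1}. 0 \<le> \<omega> x) \<and> mono_on {0..1} \<omega> \<and> continuous_on {0..1} \<omega> \<and> \<omega> 0 = 0 \<and>
     (\<forall>x\<in>{0..1}. \<forall>y\<in>{0..1}. x + y \<in> {0..1} \<longrightarrow> \<omega> (x + y) \<le> \<omega> x + \<omega> y)"

text \<open>For continuous \<open>g\<close> on \<open>[0,1]\<close> and \<open>\<delta> \<ge> 0\<close> the following supremum is a maximum, by compactness.\<close>

definition osc_modulus :: "(real \<Rightarrow> real) \<Rightarrow> real \<Rightarrow> real" where
  "osc_modulus g \<delta> = Sup {\<bar>g x - g y\<bar> | x y. x \<in> {0..1} \<and> y \<in> {0..1} \<and> \<bar>x - y\<bar> \<le> \<delta>}"

definition Diff0_mod :: "(real \<Rightarrow> real) \<Rightarrow> (real \<Rightarrow> real) set" where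
  "Diff0_mod \<omega> = {f \<in> Diff0. \<exists>K. \<forall>\<delta>\<in>{0..1}. osc_modulus (deriv01 f) \<delta> \<le> K * \<omega> \<delta>}"

end

theory Submission
  imports Defs "HOL-Real_Asymp.Real_Asymp"
begin

text \<open>
  For all the moduli considered the logarithm of the bound is \<open>2 log n\<close> to leading order, and one
  explicit diffeomorphism serves them all.

  \<^emph>\<open>Both sides are about \<open>2 log n\<close>.\<close> Since \<open>\<omega>(x) / x\<^sup>\<alpha>\<close> increases near \<open>0\<close>, there is \<open>K\<close> with
  \<open>\<omega>(x) \<le> K x\<^sup>\<alpha>\<close> near \<open>0\<close>. Hence \<open>\<omega>\<^sup>-\<^sup>1(1/n)\<close> is at least a constant times \<open>n\<close> to the power \<open>-1/\<alpha>\<close>, so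
  the logarithm of \<open>n / \<omega>\<^sup>-\<^sup>1(1/n)\<close> is at most \<open>(1 + 1/\<alpha>) log n + C\<close>
  (\<open>modulus_inverse_log_bound\<close>). With \<open>\<alpha> = 1 - \<epsilon>\<close> the factor \<open>1 - \<epsilon>\<close> turns this into
  \<open>(2 - \<epsilon>) log n + C'\<close>, which any \<open>f\<close> with \<open>\<Gamma>\<^sub>n(f)\<close> of order \<open>n\<^sup>2\<close> eventually exceeds.

  \<^emph>\<open>Lipschitz derivatives are admissible.\<close> Subadditivity forces \<open>\<omega>(\<delta>) \<ge> \<omega>(1) \<delta> / 2\<close>
  (\<open>modulus_linear_lower_bound\<close>), so a diffeomorphism whose derivative is Lipschitz lies in
  \<open>Diff0_mod \<omega>\<close>.

  \<^emph>\<open>The diffeomorphism.\<close> Let \<open>m(x) = min x (1 - x)\<close> and let \<open>f\<close> be the time-one map of the vector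
  field \<open>-m\<^sup>2\<close>. A flow carries its vector field to itself, so the derivative of the \<open>n\<close>-th iterate
  at an interior point is \<open>(m(f\<^sup>n x) / m(x))\<^sup>2\<close>. Along the flow \<open>1/m\<close> has slope \<open>1\<close> or \<open>-1\<close>, hence
  changes by at most \<open>n\<close> in time \<open>n\<close>; as \<open>m \<le> 1/2\<close>, the derivative is at most \<open>(1 + n/2)\<^sup>2\<close>, with
  equality on the orbit from \<open>1 - 1/(n+2)\<close> to \<open>1/2\<close>. The reflection of the interval conjugates \<open>f\<close> to its
  inverse, so inverse iterates have the same norms and \<open>\<Gamma>\<^sub>n(f) = (1 + n/2)\<^sup>2\<close> exactly
  (\<open>growth_seq_par\<close>). Its \<open>n\<close>-th roots tend to \<open>1\<close>.
\<close>

section \<open>Moduli of continuity\<close>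

text \<open>
  Subadditivity gives \<open>\<omega>(1) \<le> k \<omega>(1/k)\<close>; take \<open>k\<close> to be the least integer with \<open>1/k \<le> \<delta>\<close>, which costs
  the factor \<open>2\<close>.
\<close>

lemma modulus_linear_lower_bound:
  assumes "modulus_of_continuity \<omega>" and "\<delta> \<in> {0..1}"
  shows "\<omega> 1 / 2 * \<delta> \<le> \<omega> \<delta>"
proof (cases "\<delta> = 0")
  case True
  then show ?thesis using assms by (auto simp: modulus_of_continuity_def)
next
  case False
  have mono: "mono_on {0..1} \<omega>" and zero: "\<omega> 0 = 0"
    and sub: "\<And>x y. x \<in> {0..1} \<Longrightarrow> y \<in> {0..1} \<Longrightarrow> x + y \<in> {0..1} \<Longrightarrow> \<omega> (x + y) \<le> \<omega> x + \<omega> y"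
    and nonneg: "\<And>x. x \<in> {0..1} \<Longrightarrow> 0 \<le> \<omega> x"
    using assms(1) by (auto simp: modulus_of_continuity_def)
  have mult: "\<omega> (real k * x) \<le> real k * \<omega> x" if "x \<in> {0..1}" "real k * x \<le> 1" for k x
    using that(2)
  proof (induction k)
    case 0
    then show ?case using zero by simp
  next
    case (Suc k)
    have le: "real k * x + x \<le> 1" using Suc.prems by (simp add: algebra_simps)
    have "0 \<le> real k * x" "0 \<le> x" using that(1) by auto
    then have "real k * x \<in> {0..1}" "real k * x + x \<in> {0..1}"
      using le unfolding atLeastAtMost_iff by linarith+
    then have "\<omega> (real k * x + x) \<le> \<omega> (real k * x) + \<omega> x"
      using that(1) by (intro sub)
    also have "\<dots> \<le> real k * \<omega> x + \<omega> x"
      using Suc.IH le that(1) by auto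
    finally show ?case by (simp add: algebra_simps)
  qed
  have pos: "0 < \<delta>" using False assms(2) by simp
  \<comment> \<open>\<open>\<delta> \<le> 1\<close> makes rounding up at most double \<open>1/\<delta>\<close>.\<close>
  define k where "k = nat \<lceil>1 / \<delta>\<rceil>"
  have k1: "1 / \<delta> \<le> real k" unfolding k_def by linarith
  have one: "1 \<le> 1 / \<delta>" using pos assms(2) by simp
  then have k2: "real k \<le> 2 / \<delta>" unfolding k_def
    by (simp add: of_nat_nat) (use one in linarith)
  have kpos: "0 < real k" using k1 one by linarith
  have inv_le: "1 / real k \<le> \<delta>" using k1 kpos pos by (simp add: field_simps)
  have "\<omega> 1 \<le> real k * \<omega> (1 / real k)"
    using mult[of "1 / real k" k] kpos by (auto simp: field_simps)
  also have "\<dots> \<le> real k * \<omega> \<delta>"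
    using kpos inv_le assms(2) by (intro mult_left_mono mono_onD[OF mono]) auto
  also have "\<dots> \<le> 2 / \<delta> * \<omega> \<delta>"
    using k2 nonneg[OF assms(2)] by (rule mult_right_mono)
  finally show ?thesis using pos by (simp add: field_simps)
qed

lemma modulus_strict_mono_near_zero:
  fixes a \<alpha> :: real
  assumes "modulus_of_continuity \<omega>" and "0 < \<alpha>" and "a < 1"
    and inc: "strict_mono_on {0<..a} (\<lambda>x. \<omega> x / x powr \<alpha>)"
    and "0 < x" "x < y" "y \<le> a"
  shows "\<omega> x < \<omega> y"
proof -
  have "\<omega> x / x powr \<alpha> < \<omega> y / y powr \<alpha>"
    using assms by (intro strict_mono_onD[OF inc]) auto
  then have "\<omega> x < \<omega> y / y powr \<alpha> * x powr \<alpha>"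
    using \<open>0 < x\<close> by (simp add: field_simps)
  also have "\<dots> \<le> \<omega> y / y powr \<alpha> * y powr \<alpha>"
    using assms by (intro mult_left_mono powr_mono2 divide_nonneg_nonneg)
      (auto simp: modulus_of_continuity_def)
  finally show ?thesis using assms by simp
qed

text \<open>
  A modulus of continuity may be constant far from \<open>0\<close>, where \<open>the_inv_into\<close> is unspecified. Values
  strictly below \<open>\<omega>(a)\<close> are however attained exactly once on all of \<open>[0,1]\<close>: monotonicity keeps
  preimages out of \<open>[a,1]\<close>, and on \<open>(0,a]\<close> the modulus is strictly increasing.
\<close>

lemma modulus_inverse_near_zero:
  fixes a \<alpha> :: real
  assumes mod: "modulus_of_continuity \<omega>" and "0 < \<alpha>" and "0 < a" "a < 1"
    and inc: "strict_mono_on {0<..a} (\<lambda>x. \<omega> x / x powr \<alpha>)"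
    and y: "0 < y" "y < \<omega> a"
  shows "the_inv_into {0..1} \<omega> y \<in> {0<..a}" and "\<omega> (the_inv_into {0..1} \<omega> y) = y"
proof -
  have mono: "mono_on {0..1} \<omega>" and zero: "\<omega> 0 = 0" and cont: "continuous_on {0..1} \<omega>"
    using mod by (auto simp: modulus_of_continuity_def)
  have "continuous_on {0..a} \<omega>" using \<open>a < 1\<close> by (intro continuous_on_subset[OF cont]) auto
  then obtain x where x: "0 \<le> x" "x \<le> a" "\<omega> x = y"
    using IVT'[of \<omega> 0 y a] y zero \<open>0 < a\<close> by auto
  have xpos: "0 < x" using x y zero by (cases "x = 0") auto
  have uniq: "z = x" if "z \<in> {0..1}" "\<omega> z = y" for z
  proof -
    have "z \<noteq> 0" using that zero y by auto
    moreover have "z < a"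
    proof (rule ccontr)
      assume "\<not> z < a"
      then have "\<omega> a \<le> \<omega> z" using that \<open>0 < a\<close> by (intro mono_onD[OF mono]) auto
      then show False using that y by simp
    qed
    ultimately show ?thesis
      using modulus_strict_mono_near_zero[OF mod \<open>0 < \<alpha>\<close> \<open>a < 1\<close> inc, of z x]
        modulus_strict_mono_near_zero[OF mod \<open>0 < \<alpha>\<close> \<open>a < 1\<close> inc, of x z] that x xpos
      by (cases z x rule: linorder_cases) auto
  qed
  have "the_inv_into {0..1} \<omega> y = x"
    unfolding the_inv_into_def using x uniq \<open>a < 1\<close> by (intro the_equality) auto
  then show "the_inv_into {0..1} \<omega> y \<in> {0<..a}" "\<omega> (the_inv_into {0..1} \<omega> y) = y"
    using x xpos by auto
qed

text \<open>
  Taking logarithms in \<open>1/n = \<omega>(x) \<le> K x\<^sup>\<alpha>\<close> at \<open>x = \<omega>\<^sup>-\<^sup>1(1/n)\<close> bounds \<open>x\<close> from below. The lower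
  bound by \<open>0\<close> serves the case \<open>\<epsilon> \<ge> 1\<close> of the growth bound, in which \<open>1 - \<epsilon>\<close> is not positive.
\<close>

lemma modulus_inverse_log_bound:
  fixes \<omega> :: "real \<Rightarrow> real" and \<alpha> :: real
  assumes mod: "modulus_of_continuity \<omega>" and \<alpha>: "0 < \<alpha>" and "0 < a" "a < 1"
    and inc: "strict_mono_on {0<..a} (\<lambda>x. \<omega> x / x powr \<alpha>)"
  shows "\<exists>C. \<forall>\<^sub>F n in sequentially.
           0 \<le> ln (real n / the_inv_into {0..1} \<omega> (1 / real n)) \<and>
           ln (real n / the_inv_into {0..1} \<omega> (1 / real n)) \<le> (1 + 1 / \<alpha>) * ln (real n) + C"
proof -
  have "0 \<le> \<omega> (a / 2)" using mod \<open>0 < a\<close> \<open>a < 1\<close> by (auto simp: modulus_of_continuity_def)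
  also have "\<dots> < \<omega> a"
    by (rule modulus_strict_mono_near_zero[OF mod \<alpha> \<open>a < 1\<close> inc]) (use \<open>0 < a\<close> in auto)
  finally have wa: "0 < \<omega> a" .
  define K where "K = \<omega> a / a powr \<alpha>"
  have K: "0 < K" using wa \<open>0 < a\<close> by (simp add: K_def)
  have "\<forall>\<^sub>F n in sequentially. 1 / real n < \<omega> a"
    using wa by real_asymp
  then have "\<forall>\<^sub>F n in sequentially. n \<ge> 1 \<and> 1 / real n < \<omega> a"
    using eventually_ge_at_top[of 1] by eventually_elim auto
  then have "\<forall>\<^sub>F n in sequentially.
           0 \<le> ln (real n / the_inv_into {0..1} \<omega> (1 / real n)) \<and>
           ln (real n / the_inv_into {0..1} \<omega> (1 / real n)) \<le> (1 + 1 / \<alpha>) * ln (real n) + ln K / \<alpha>"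
  proof eventually_elim
    case (elim n)
    define x where "x = the_inv_into {0..1} \<omega> (1 / real n)"
    have n: "1 \<le> real n" using elim by simp
    have x: "0 < x" "x \<le> a" "\<omega> x = 1 / real n"
      using modulus_inverse_near_zero[OF mod \<alpha> \<open>0 < a\<close> \<open>a < 1\<close> inc, of "1 / real n"] elim
      by (auto simp: x_def)
    have "\<omega> x / x powr \<alpha> \<le> K"
      using strict_mono_onD[OF inc, of x a] x \<open>0 < a\<close> unfolding K_def by (cases "x = a") auto
    then have "\<omega> x \<le> K * x powr \<alpha>" using x(1) by (simp add: pos_divide_le_eq)
    then have "1 / real n \<le> K * x powr \<alpha>" unfolding x(3) .
    then have "ln (1 / real n) \<le> ln (K * x powr \<alpha>)" using n x K by (subst ln_le_cancel_iff) auto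
    then have "- ln (real n) \<le> ln K + \<alpha> * ln x" using n x K by (simp add: ln_div ln_mult ln_powr)
    then have "- ln x \<le> ln (real n) / \<alpha> + ln K / \<alpha>" using \<alpha> by (simp add: field_simps)
    moreover have "ln (real n / x) = ln (real n) - ln x" using n x by (simp add: ln_div)
    moreover have "0 \<le> ln (real n)" "ln x \<le> 0" using n x \<open>a < 1\<close> by auto
    ultimately show ?case unfolding x_def[symmetric] by (auto simp: algebra_simps)
  qed
  then show ?thesis by blast
qed

section \<open>A parabolic diffeomorphism with explicit growth\<close>

text \<open>
  The time-one map of the vector field \<open>-m\<^sup>2\<close>, \<open>m(x) = min x (1 - x)\<close>. The flow translates the
  coordinate \<open>h(x) = 1/x - 2\<close> for \<open>x \<le> 1/2\<close>, \<open>h(x) = 2 - 1/(1 - x)\<close> for \<open>x \<ge> 1/2\<close>, so \<open>h(par x) = h(x) + 1\<close>.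
  In the first and last pieces \<open>x\<close> and \<open>par x\<close> lie on the same side of \<open>1/2\<close>; in the middle piece the
  step crosses \<open>1/2\<close>.
\<close>

definition par :: "real \<Rightarrow> real" where
  "par x = (if x \<le> 1/2 then x / (1 + x) else if x \<le> 2/3 then (1 - x) / (4 - 5 * x) else 2 - 1 / x)"

text \<open>
  The square root of \<open>1 / par'\<close>, which on the three pieces is \<open>1 + x\<close>, \<open>4 - 5x\<close> and \<open>x\<close>. As maximum
  and minimum of affine functions it is visibly Lipschitz, and so is the derivative of \<open>par\<close>.
\<close>

definition par_q :: "real \<Rightarrow> real" where
  "par_q x = max (min (1 + x) (4 - 5 * x)) x"

definition edge_dist :: "real \<Rightarrow> real" where
  "edge_dist x = min x (1 - x)"

lemma par_maps: "x \<in> {0..1} \<Longrightarrow> par x \<in> {0..1}"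
  by (auto simp: par_def field_simps)

lemma par_middle: "1/2 \<le> x \<Longrightarrow> x \<le> 2/3 \<Longrightarrow> par x = (1 - x) / (4 - 5 * x)"
proof (cases "x = 1/2")
  case True
  show ?thesis unfolding True by (simp add: par_def)
qed (simp add: par_def)

lemma par_right: "2/3 \<le> x \<Longrightarrow> par x = 2 - 1 / x"
proof (cases "x = 2/3")
  case True
  show ?thesis unfolding True by (simp add: par_def)
qed (simp add: par_def)

text \<open>
  The reflection reverses the flow, because \<open>h(1 - x) = - h(x)\<close> in the translation coordinate \<open>h\<close> of
  \<open>par\<close>: reflecting, applying \<open>par\<close> and reflecting again undoes \<open>par\<close>.
\<close>

lemma par_reflect_inverse:
  assumes "x \<in> {0..1}"
  shows "par (1 - par x) = 1 - x"
proof -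
  consider "x \<le> 1/2" | "1/2 < x" "x \<le> 2/3" | "2/3 < x" by linarith
  then show ?thesis
  proof cases
    case 1
    then have eq: "par x = x / (1 + x)" by (simp add: par_def)
    have "1 - par x \<ge> 2/3" using 1 assms by (simp add: eq field_simps)
    then have "par (1 - par x) = 2 - 1 / (1 - par x)"
      using par_right[of "1 - par x"] by simp
    moreover have "1 / (1 - par x) = 1 + x" using assms by (simp add: eq field_simps)
    ultimately show ?thesis by simp
  next
    case 2
    then have eq: "par x = (1 - x) / (4 - 5 * x)" by (simp add: par_def)
    have pos: "4 - 5 * x > 0" using 2 by simp
    have "par x > 1/3" "par x \<le> 1/2" using 2 pos by (simp_all add: eq field_simps)
    then have "par (1 - par x) = par x / (5 * par x - 1)"
      using par_middle[of "1 - par x"] by (simp add: algebra_simps)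
    also have "5 * par x - 1 = 1 / (4 - 5 * x)" using pos by (simp add: eq field_simps)
    finally show ?thesis using pos by (simp add: eq)
  next
    case 3
    then have eq: "par x = 2 - 1 / x" by (simp add: par_def)
    have "1 - par x \<le> 1/2" using 3 assms by (simp add: eq field_simps)
    then have "par (1 - par x) = (1 - par x) / (2 - par x)" by (simp add: par_def)
    also have "\<dots> = (1 / x - 1) / (1 / x)" by (simp add: eq)
    also have "\<dots> = 1 - x" using 3 by (simp add: field_simps)
    finally show ?thesis .
  qed
qed

lemma par_q_ge: "x \<in> {0..1} \<Longrightarrow> 2/3 \<le> par_q x"
  by (auto simp: par_q_def max_def min_def)

lemma par_q_lipschitz: "\<bar>par_q x - par_q y\<bar> \<le> 5 * \<bar>x - y\<bar>"
  by (auto simp: par_q_def max_def min_def abs_if)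

text \<open>
  Invariance of the vector field under its own flow, after taking square roots. In this product form it
  also holds at the end points, and it telescopes along orbits.
\<close>

lemma edge_dist_par:
  assumes "x \<in> {0..1}"
  shows "edge_dist x = par_q x * edge_dist (par x)"
proof -
  consider "x \<le> 1/2" | "1/2 < x" "x \<le> 2/3" | "2/3 < x" by linarith
  then show ?thesis
  proof cases
    case 1
    then have "par x = x / (1 + x)" "x / (1 + x) \<le> 1/2" "par_q x = 1 + x"
      using assms by (auto simp: par_def par_q_def field_simps)
    then show ?thesis using 1 assms by (simp add: edge_dist_def min_def)
  next
    case 2
    then have "par x = (1 - x) / (4 - 5 * x)" "(1 - x) / (4 - 5 * x) \<le> 1/2" "par_q x = 4 - 5 * x"
      by (auto simp: par_def par_q_def field_simps)
    then show ?thesis using 2 by (simp add: edge_dist_def min_def)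
  next
    case 3
    then have "edge_dist x = 1 - x" "edge_dist (par x) = 1 / x - 1" "par_q x = x"
      by (auto simp: par_def par_q_def edge_dist_def min_def field_simps)
    then show ?thesis using 3 by (simp add: field_simps)
  qed
qed

lemma edge_dist_pos_iff: "0 < edge_dist x \<longleftrightarrow> x \<in> {0<..<1}"
  by (auto simp: edge_dist_def)

lemma par_interior:
  assumes "x \<in> {0<..<1}"
  shows "par x \<in> {0<..<1}"
proof -
  have "0 < par_q x * edge_dist (par x)"
    using edge_dist_par[of x] edge_dist_pos_iff[of x] assms by auto
  then have "0 < edge_dist (par x)" using par_q_ge[of x] assms by (simp add: zero_less_mult_iff)
  then show ?thesis by (simp add: edge_dist_pos_iff)
qed

text \<open>
  In one unit of time \<open>1/m\<close> decreases by at most \<open>1\<close>, that is, \<open>1/m(par x) = q/m(x) \<ge> (1 - m(x))/m(x)\<close>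
  with \<open>q = par_q x\<close>.
\<close>

lemma inverse_edge_dist_step:
  assumes "x \<in> {0<..<1}"
  shows "1 / edge_dist x \<le> 1 / edge_dist (par x) + 1"
proof -
  have pos: "0 < edge_dist x" "0 < edge_dist (par x)"
    using edge_dist_pos_iff par_interior assms by auto
  have "par_q x \<ge> 1 - edge_dist x" 
    using assms by (auto simp: par_q_def edge_dist_def min_def)
  moreover have "edge_dist (par x) = edge_dist x / par_q x"
    using edge_dist_par[of x] assms par_q_ge[of x] by auto
  ultimately show ?thesis using pos by (auto simp: field_simps)
qed

text \<open>
  The derivatives of neighbouring pieces agree at \<open>1/2\<close> and \<open>2/3\<close>. The interval is covered by
  three closed pieces, and a difference quotient that has the same limit within each of them has it
  within their union; within a piece that does not contain \<open>x\<close> the limit statement is vacuous.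
\<close>

lemma par_has_derivative:
  assumes "x \<in> {0..1}"
  shows "(par has_real_derivative 1 / (par_q x)\<^sup>2) (at x within {0..1})"
proof -
  have left: "(par has_real_derivative 1 / (par_q x)\<^sup>2) (at x within {0..1/2})" if "x \<in> {0..1/2}"
  proof (rule has_field_derivative_transform_within[OF _ zero_less_one])
    have "par_q x = 1 + x" using that by (auto simp: par_q_def)
    then show "((\<lambda>x. x / (1 + x)) has_real_derivative 1 / (par_q x)\<^sup>2) (at x within {0..1/2})"
      using that by (auto intro!: derivative_eq_intros simp: power2_eq_square field_simps)
  qed (use that in \<open>auto simp: par_def\<close>)
  have middle: "(par has_real_derivative 1 / (par_q x)\<^sup>2) (at x within {1/2..2/3})"
    if "x \<in> {1/2..2/3}"
  proof (rule has_field_derivative_transform_within[OF _ zero_less_one])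
    have q: "par_q x = 4 - 5 * x" using that by (auto simp: par_q_def)
    show "((\<lambda>x. (1 - x) / (4 - 5 * x)) has_real_derivative 1 / (par_q x)\<^sup>2)
        (at x within {1/2..2/3})"
      unfolding q using that
      by (auto intro!: derivative_eq_intros simp: power2_eq_square field_simps)
  qed (use that in \<open>auto simp: par_middle\<close>)
  have right: "(par has_real_derivative 1 / (par_q x)\<^sup>2) (at x within {2/3..1})"
    if "x \<in> {2/3..1}"
  proof (rule has_field_derivative_transform_within[OF _ zero_less_one])
    have "par_q x = x" using that by (auto simp: par_q_def)
    then show "((\<lambda>x. 2 - 1 / x) has_real_derivative 1 / (par_q x)\<^sup>2) (at x within {2/3..1})"
      using that by (auto intro!: derivative_eq_intros simp: power2_eq_square field_simps)
  qed (use that in \<open>auto simp: par_right\<close>)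
  have away: "(par has_real_derivative 1 / (par_q x)\<^sup>2) (at x within {b..c})"
    if "x \<notin> {b..c}" for b c
  proof -
    have "{b..c} - {x} = {b..c}" using that by auto
    then have "at x within {b..c} = bot"
      using that by (simp add: at_within_eq_bot_iff)
    then show ?thesis by (simp add: has_field_derivative_iff)
  qed
  have "{0..1} = {0..1/2} \<union> ({1/2..2/3} \<union> {2/3..1::real})" by auto
  moreover have "(par has_real_derivative 1 / (par_q x)\<^sup>2)
      (at x within {0..1/2} \<union> ({1/2..2/3} \<union> {2/3..1}))"
    using left middle right away unfolding has_field_derivative_iff
    by (intro Lim_Un) blast+
  ultimately show ?thesis by simp
qed

section \<open>The inverse and its derivative\<close>

definition par_inv :: "real \<Rightarrow> real" where
  "par_inv x = 1 - par (1 - x)"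

lemma par_inv_par: "x \<in> {0..1} \<Longrightarrow> par_inv (par x) = x"
  by (simp add: par_inv_def par_reflect_inverse)

lemma par_par_inv: "x \<in> {0..1} \<Longrightarrow> par (par_inv x) = x"
  using par_reflect_inverse[of "1 - x"] by (simp add: par_inv_def)

lemma par_inv_maps: "x \<in> {0..1} \<Longrightarrow> par_inv x \<in> {0..1}"
  using par_maps[of "1 - x"] by (simp add: par_inv_def)

lemma bij_betw_par: "bij_betw par {0..1} {0..1}"
  by (rule bij_betw_byWitness[of _ par_inv])
    (use par_inv_par par_par_inv par_maps par_inv_maps in blast)+

lemma inv01_par: "x \<in> {0..1} \<Longrightarrow> inv01 par x = par_inv x"
  unfolding inv01_def using bij_betw_par par_par_inv par_inv_maps
  by (intro the_inv_into_f_eq) (auto simp: bij_betw_def)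

lemma par_funpow_maps: "x \<in> {0..1} \<Longrightarrow> (par ^^ n) x \<in> {0..1}"
  by (induction n) (use par_maps in auto)

lemma inv01_par_funpow:
  assumes "x \<in> {0..1}"
  shows "(inv01 par ^^ n) x = 1 - (par ^^ n) (1 - x)"
proof (induction n)
  case (Suc n)
  have "(par ^^ n) (1 - x) \<in> {0..1}" using assms by (intro par_funpow_maps) auto
  then show ?case by (simp add: Suc inv01_par par_inv_def)
qed simp

text \<open>
  Replacing \<open>f\<close> by a function \<open>g\<close> that agrees with it on \<open>[0,1]\<close> is needed because \<open>inv01\<close> is
  unspecified elsewhere.
\<close>

lemma deriv01_eq:
  assumes "x \<in> {0..1}" and "\<And>y. y \<in> {0..1} \<Longrightarrow> f y = g y"
    and "(g has_real_derivative D) (at x within {0..1})"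
  shows "deriv01 f x = D" and "(f has_real_derivative D) (at x within {0..1})"
proof -
  show der: "(f has_real_derivative D) (at x within {0..1})"
    using assms(3) zero_less_one assms(1) by (rule has_field_derivative_transform_within) (use assms(2) in auto)
  show "deriv01 f x = D" unfolding deriv01_def
    using der assms(1)
    by (intro vector_derivative_within_cbox[of 0 1, unfolded cbox_interval])
      (auto simp: has_real_derivative_iff_has_vector_derivative)
qed

lemma reflect_has_derivative:
  assumes "x \<in> {0..1}" and "(f has_real_derivative D) (at (1 - x) within {0..1})"
  shows "((\<lambda>x. 1 - f (1 - x)) has_real_derivative D) (at x within {0..1})"
proof -
  have img: "(\<lambda>x. 1 - x) ` {0..1} = {0..1::real}"
    by (auto simp: image_iff intro!: bexI[of _ "1 - _"])
  have "((\<lambda>x. f (1 - x)) has_real_derivative D * (- 1)) (at x within {0..1})"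
    by (rule DERIV_image_chain[where f = f and g = "\<lambda>x. 1 - x" and s = "{0..1}", unfolded img o_def, OF assms(2)])
      (auto intro!: derivative_eq_intros)
  then show ?thesis by (auto intro!: derivative_eq_intros)
qed

section \<open>Growth of the iterates\<close>

definition par_qn :: "nat \<Rightarrow> real \<Rightarrow> real" where
  "par_qn n x = (\<Prod>k<n. par_q ((par ^^ k) x))"

lemma par_funpow_has_derivative:
  assumes "x \<in> {0..1}"
  shows "(par ^^ n has_real_derivative 1 / (par_qn n x)\<^sup>2) (at x within {0..1})"
proof (induction n)
  case 0
  show ?case by (simp add: par_qn_def id_def)
next
  case (Suc n)
  have "(par has_real_derivative 1 / (par_q ((par ^^ n) x))\<^sup>2)
      (at ((par ^^ n) x) within (par ^^ n) ` {0..1})"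
    by (rule DERIV_subset[OF par_has_derivative]) (use par_funpow_maps assms in blast)+
  from DERIV_image_chain[OF this Suc] show ?case
    by (simp add: par_qn_def power_mult_distrib mult.commute o_def)
qed

text \<open>At interior points this evaluates the product: \<open>par_qn n x = m(x) / m(par\<^sup>n x)\<close>.\<close>

lemma edge_dist_par_funpow:
  assumes "x \<in> {0..1}"
  shows "edge_dist x = par_qn n x * edge_dist ((par ^^ n) x)"
proof (induction n)
  case (Suc n)
  then show ?case using edge_dist_par[OF par_funpow_maps[OF assms, of n]] by (simp add: par_qn_def)
qed (simp add: par_qn_def)

lemma par_qn_pos:
  assumes "x \<in> {0..1}"
  shows "0 < par_qn n x"
  unfolding par_qn_def
proof (rule prod_pos)
  show "0 < par_q ((par ^^ k) x)" for k
    using par_q_ge[OF par_funpow_maps[OF assms, of k]] by simp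
qed

lemma par_funpow_interior: "x \<in> {0<..<1} \<Longrightarrow> (par ^^ n) x \<in> {0<..<1}"
  by (induction n) (use par_interior in auto)

lemma inverse_edge_dist_funpow:
  assumes "x \<in> {0<..<1}"
  shows "1 / edge_dist x \<le> 1 / edge_dist ((par ^^ n) x) + real n"
proof (induction n)
  case (Suc n)
  then show ?case using inverse_edge_dist_step[OF par_funpow_interior[OF assms, of n]] by simp
qed simp

text \<open>
  Put \<open>y = par\<^sup>n x\<close>. In the interior the left-hand side is \<open>m(y) (1/m(x)) \<le> m(y) (1/m(y) + n) = 1 + n m(y)\<close>,
  and \<open>m \<le> 1/2\<close>. At the end points, where \<open>m\<close> vanishes, all factors of \<open>par_qn\<close> are \<open>1\<close>.
\<close>

lemma inverse_par_qn_le: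
  assumes "x \<in> {0..1}"
  shows "1 / par_qn n x \<le> 1 + real n / 2"
proof (cases "x \<in> {0<..<1}")
  case True
  define y where "y = (par ^^ n) x"
  have pos: "0 < edge_dist x" "0 < edge_dist y"
    using True par_funpow_interior edge_dist_pos_iff unfolding y_def by auto
  have "edge_dist x = par_qn n x * edge_dist y"
    using edge_dist_par_funpow[OF assms] y_def by simp
  then have "1 / par_qn n x = edge_dist y * (1 / edge_dist x)" using pos by auto
  also have "\<dots> \<le> edge_dist y * (1 / edge_dist y + real n)"
    using pos inverse_edge_dist_funpow[OF True, of n] by (intro mult_left_mono) (auto simp: y_def)
  also have "\<dots> = 1 + real n * edge_dist y" using pos by (simp add: distrib_left)
  also have "\<dots> \<le> 1 + real n * (1/2)"
    by (intro add_left_mono mult_left_mono) (auto simp: edge_dist_def min_def)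
  finally show ?thesis by simp
next
  case False
  then have x: "x = 0 \<or> x = 1" using assms by auto
  have "(par ^^ k) x = x" for k
    by (induction k) (use x in \<open>auto simp: par_def\<close>)
  moreover have "par_q x = 1" using x by (auto simp: par_q_def)
  ultimately show ?thesis by (simp add: par_qn_def)
qed

text \<open>
  At \<open>1 - 1/(j+1)\<close> the coordinate \<open>1/m\<close> equals \<open>j + 1\<close>, and each step on the right half decreases it by
  exactly \<open>1\<close>; after \<open>n\<close> steps it reaches \<open>2\<close>, its minimum. Along this orbit the bound on \<open>1 / par_qn\<close>
  is therefore sharp.
\<close>

lemma par_funpow_orbit: "k \<le> n \<Longrightarrow> (par ^^ k) (1 - 1 / real (n + 2)) = 1 - 1 / real (n + 2 - k)"
proof (induction k)
  case (Suc k)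
  define j where "j = real (n + 1 - k)"
  have j: "real (n + 2 - k) = j + 1" "real (n + 2 - Suc k) = j" "2 \<le> j"
    using Suc.prems by (auto simp: j_def of_nat_diff)
  have "par (1 - 1 / (j + 1)) = 2 - 1 / (1 - 1 / (j + 1))"
    by (rule par_right) (use j in \<open>simp add: field_simps\<close>)
  also have "\<dots> = 1 - 1 / j" using j by (simp add: field_simps)
  finally have "par (1 - 1 / (j + 1)) = 1 - 1 / j" .
  moreover have "(par ^^ k) (1 - 1 / real (n + 2)) = 1 - 1 / real (n + 2 - k)"
    by (rule Suc.IH) (use Suc.prems in simp)
  ultimately show ?case by (simp only: funpow.simps o_apply j(1,2))
qed simp

lemma inverse_par_qn_attained:
  "1 / par_qn n (1 - 1 / real (n + 2)) = 1 + real n / 2"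
proof -
  define x where "x = 1 - 1 / real (n + 2)"
  have x: "x \<in> {0..1}" "edge_dist x = 1 / real (n + 2)"
    by (auto simp: x_def edge_dist_def field_simps)
  have "(par ^^ n) x = 1/2" using par_funpow_orbit[of n n] by (simp add: x_def)
  then have "edge_dist ((par ^^ n) x) = 1/2" by (simp only: edge_dist_def)
  then have "1 / real (n + 2) = par_qn n x * (1/2)"
    using edge_dist_par_funpow[OF x(1), of n] unfolding x(2) by simp
  then have "par_qn n x = 2 / real (n + 2)" by simp
  then have "1 / par_qn n x = real (n + 2) / 2" by simp
  then show ?thesis unfolding x_def[symmetric] by simp
qed

lemma unif_norm_eqI:
  assumes "\<And>x. x \<in> {0..1} \<Longrightarrow> \<bar>g x\<bar> \<le> M" and "z \<in> {0..1}" "\<bar>g z\<bar> = M"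
  shows "unif_norm g = M"
  unfolding unif_norm_def using assms by (intro cSup_eq_maximum) auto

theorem growth_seq_par: "growth_seq n par = (1 + real n / 2)\<^sup>2"
proof -
  define z where "z = 1 - 1 / real (n + 2)"
  have z: "z \<in> {0..1}" "1 - z \<in> {0..1}" by (auto simp: z_def field_simps)
  have der: "deriv01 (par ^^ n) x = (1 / par_qn n x)\<^sup>2" if "x \<in> {0..1}" for x
    using deriv01_eq(1)[OF that _ par_funpow_has_derivative[OF that]] by (simp add: power_divide)
  have der_inv: "deriv01 (inv01 par ^^ n) x = (1 / par_qn n (1 - x))\<^sup>2" if "x \<in> {0..1}" for x
    using deriv01_eq(1)[OF that inv01_par_funpow
        reflect_has_derivative[OF that par_funpow_has_derivative]] that
    by (simp add: power_divide)
  have le: "\<bar>(1 / par_qn n x)\<^sup>2\<bar> \<le> (1 + real n / 2)\<^sup>2" if "x \<in> {0..1}" for x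
    using inverse_par_qn_le[OF that, of n] par_qn_pos[OF that, of n] by (simp add: power_mono del: power_divide)
  have eq: "\<bar>(1 / par_qn n z)\<^sup>2\<bar> = (1 + real n / 2)\<^sup>2"
    using inverse_par_qn_attained[of n] unfolding z_def by simp
  have "unif_norm (deriv01 (par ^^ n)) = (1 + real n / 2)\<^sup>2"
    using le eq z by (intro unif_norm_eqI[of _ _ z]) (simp_all only: der)
  moreover have "unif_norm (deriv01 (inv01 par ^^ n)) = (1 + real n / 2)\<^sup>2"
  proof (rule unif_norm_eqI[OF _ z(2)])
    show "\<bar>deriv01 (inv01 par ^^ n) x\<bar> \<le> (1 + real n / 2)\<^sup>2" if "x \<in> {0..1}" for x
      unfolding der_inv[OF that] by (rule le) (use that in auto)
    show "\<bar>deriv01 (inv01 par ^^ n) (1 - z)\<bar> = (1 + real n / 2)\<^sup>2"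
      unfolding der_inv[OF z(2)] using eq by simp
  qed
  ultimately show ?thesis by (simp add: growth_seq_def)
qed

lemma growth_rate_par: "growth_rate par = 1"
proof -
  have "(\<lambda>n. ((1 + real n / 2)\<^sup>2) powr (1 / real n)) \<longlonglongrightarrow> 1" by real_asymp
  moreover have "\<forall>\<^sub>F n in sequentially.
      ((1 + real n / 2)\<^sup>2) powr (1 / real n) = root n (growth_seq n par)"
    using eventually_gt_at_top[of 0]
    by eventually_elim (simp add: growth_seq_par root_powr_inverse)
  ultimately have "(\<lambda>n. root n (growth_seq n par)) \<longlonglongrightarrow> 1"
    by (rule Lim_transform_eventually)
  then show ?thesis unfolding growth_rate_def by (rule limI)
qed

section \<open>Regularity\<close>

text \<open>
  For \<open>u = 1 / par_q x\<close> and \<open>v = 1 / par_q y\<close>, which are at most \<open>3/2\<close>, one has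
  \<open>u\<^sup>2 - v\<^sup>2 = (u + v) u v (par_q y - par_q x)\<close>; so the constant is \<open>3 (9/4) 5\<close>.
\<close>

lemma inverse_square_par_q_lipschitz:
  assumes "x \<in> {0..1}" "y \<in> {0..1}"
  shows "\<bar>1 / (par_q x)\<^sup>2 - 1 / (par_q y)\<^sup>2\<bar> \<le> 135/4 * \<bar>x - y\<bar>"
proof -
  define u v where uv: "u = 1 / par_q x" "v = 1 / par_q y"
  have q: "2/3 \<le> par_q x" "2/3 \<le> par_q y" using par_q_ge assms by auto
  have u: "0 < u" "u \<le> 3/2" "0 < v" "v \<le> 3/2" using q by (auto simp: uv field_simps)
  have "1 / (par_q x)\<^sup>2 - 1 / (par_q y)\<^sup>2 = (u + v) * (u * v * (par_q y - par_q x))"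
    using q by (simp add: uv field_simps power2_eq_square)
  then have "\<bar>1 / (par_q x)\<^sup>2 - 1 / (par_q y)\<^sup>2\<bar> = (u + v) * (u * v * \<bar>par_q y - par_q x\<bar>)"
    using u by (simp add: abs_mult)
  also have "\<dots> \<le> (3/2 + 3/2) * (3/2 * (3/2) * (5 * \<bar>y - x\<bar>))"
    using u par_q_lipschitz[of y x] by (intro mult_mono add_mono) auto
  also have "\<dots> \<le> 135/4 * \<bar>x - y\<bar>" by (simp add: abs_minus_commute)
  finally show ?thesis .
qed

lemma deriv01_par: "x \<in> {0..1} \<Longrightarrow> deriv01 par x = 1 / (par_q x)\<^sup>2"
  using deriv01_eq(1)[OF _ refl par_has_derivative] .

lemma par_Diff0: "par \<in> Diff0"
proof -
  have "par_q x \<noteq> 0" if "x \<in> {0..1}" for x using par_q_ge[OF that] by simp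
  moreover have "continuous_on {0..1} par_q" unfolding par_q_def by (intro continuous_intros)
  ultimately have cont_q: "continuous_on {0..1} (\<lambda>x. 1 / (par_q x)\<^sup>2)"
    by (intro continuous_intros) auto
  have "C1_on01 par" unfolding C1_on01_def
  proof
    show "par differentiable_on {0..1}"
      using par_has_derivative real_differentiable_def unfolding differentiable_on_def
      by blast
    show "continuous_on {0..1} (deriv01 par)"
      using cont_q by (rule continuous_on_eq) (simp add: deriv01_par)
  qed
  moreover have "C1_on01 (inv01 par)" unfolding C1_on01_def
  proof
    have der: "deriv01 (inv01 par) x = 1 / (par_q (1 - x))\<^sup>2"
      "(inv01 par has_real_derivative 1 / (par_q (1 - x))\<^sup>2) (at x within {0..1})"
      if "x \<in> {0..1}" for x
      using deriv01_eq[OF that inv01_par[unfolded par_inv_def]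
          reflect_has_derivative[OF that par_has_derivative]] that by auto
    show "inv01 par differentiable_on {0..1}"
      using der(2) real_differentiable_def unfolding differentiable_on_def by blast
    have "continuous_on {0..1} (\<lambda>x. 1 / (par_q (1 - x))\<^sup>2)"
      by (rule continuous_on_compose2[OF cont_q]) (auto intro!: continuous_intros)
    then show "continuous_on {0..1} (deriv01 (inv01 par))"
      by (rule continuous_on_eq) (simp add: der)
  qed
  ultimately show ?thesis
    using bij_betw_par by (simp add: Diff0_def par_def)
qed

lemma osc_modulus_le:
  assumes "0 \<le> \<delta>" and "\<And>x y. x \<in> {0..1} \<Longrightarrow> y \<in> {0..1} \<Longrightarrow> \<bar>x - y\<bar> \<le> \<delta> \<Longrightarrow> \<bar>g x - g y\<bar> \<le> B"
  shows "osc_modulus g \<delta> \<le> B"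
  unfolding osc_modulus_def
proof (rule cSup_least)
  have "\<bar>g 0 - g 0\<bar> \<in> {\<bar>g x - g y\<bar> |x y. x \<in> {0..1} \<and> y \<in> {0..1} \<and> \<bar>x - y\<bar> \<le> \<delta>}"
    using assms(1) by (intro CollectI exI[of _ 0]) auto
  then show "{\<bar>g x - g y\<bar> |x y. x \<in> {0..1} \<and> y \<in> {0..1} \<and> \<bar>x - y\<bar> \<le> \<delta>} \<noteq> {}" by blast
qed (use assms(2) in auto)

lemma par_Diff0_mod:
  assumes "modulus_of_continuity \<omega>" and "0 < \<omega> 1"
  shows "par \<in> Diff0_mod \<omega>"
proof -
  have "osc_modulus (deriv01 par) \<delta> \<le> 135/4 * 2 / \<omega> 1 * \<omega> \<delta>" if "\<delta> \<in> {0..1}" for \<delta>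
  proof (rule osc_modulus_le)
    fix x y :: real
    assume xy: "x \<in> {0..1}" "y \<in> {0..1}" "\<bar>x - y\<bar> \<le> \<delta>"
    have "\<bar>deriv01 par x - deriv01 par y\<bar> \<le> 135/4 * \<bar>x - y\<bar>"
      using inverse_square_par_q_lipschitz xy by (simp add: deriv01_par)
    also have "\<dots> \<le> 135/4 * \<delta>" using xy by simp
    also have "\<dots> \<le> 135/4 * (2 / \<omega> 1 * \<omega> \<delta>)"
      using modulus_linear_lower_bound[OF assms(1) that] assms(2)
      by (intro mult_left_mono) (auto simp: field_simps)
    finally show "\<bar>deriv01 par x - deriv01 par y\<bar> \<le> 135/4 * 2 / \<omega> 1 * \<omega> \<delta>" by simp
  qed (use that in simp)
  then show ?thesis using par_Diff0 unfolding Diff0_mod_def by blast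
qed

section \<open>The growth bound\<close>

theorem theorem6:
  fixes \<omega> :: "real \<Rightarrow> real"
  assumes "modulus_of_continuity \<omega>"
    and "\<And>\<alpha>. 0 < \<alpha> \<Longrightarrow> \<alpha> < 1 \<Longrightarrow>
           \<exists>a. 0 < a \<and> a < 1 \<and> strict_mono_on {0<..a} (\<lambda>x. \<omega> x / x powr \<alpha>)"
    and "((\<lambda>x. \<omega> x / (x * ln (exp 1 / x))) \<longlongrightarrow> 0) (at_right 0)"
  shows "\<exists>f\<in>Diff0_mod \<omega>. growth_rate f = 1 \<and>
           (\<exists>c>0. \<forall>\<epsilon>>0. \<forall>\<^sub>F n in sequentially.
              ln (growth_seq n f) \<ge> (1 - \<epsilon>) * ln (real n / the_inv_into {0..1} \<omega> (c / real n)))"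
proof (intro bexI conjI exI allI impI)
  have log_bound: "\<exists>C. \<forall>\<^sub>F n in sequentially.
      0 \<le> ln (real n / the_inv_into {0..1} \<omega> (1 / real n)) \<and>
      ln (real n / the_inv_into {0..1} \<omega> (1 / real n)) \<le> (1 + 1 / \<alpha>) * ln (real n) + C"
    if "0 < \<alpha>" "\<alpha> < 1" for \<alpha> :: real
    using assms(2)[OF that] modulus_inverse_log_bound[OF assms(1) that(1)] by blast
  \<comment> \<open>Only \<open>\<omega> 1 > 0\<close> is wanted here; any exponent in \<open>(0,1)\<close> would do.\<close>
  obtain a where a: "0 < a" "a < 1" "strict_mono_on {0<..a} (\<lambda>x. \<omega> x / x powr (1/2))"
    using assms(2)[of "1/2"] by auto
  have "0 \<le> \<omega> (a / 2)" using assms(1) a by (auto simp: modulus_of_continuity_def)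
  also have "\<dots> < \<omega> a"
    by (rule modulus_strict_mono_near_zero[OF assms(1) _ a(2,3)]) (use a in auto)
  also have "\<dots> \<le> \<omega> 1"
    using assms(1) a by (auto simp: modulus_of_continuity_def intro: mono_onD)
  finally show "par \<in> Diff0_mod \<omega>" by (rule par_Diff0_mod[OF assms(1)])
  show "growth_rate par = 1" by (rule growth_rate_par)
  show "(1::real) > 0" by simp
  fix \<epsilon> :: real
  assume "\<epsilon> > 0"
  show "\<forall>\<^sub>F n in sequentially.
      ln (growth_seq n par) \<ge> (1 - \<epsilon>) * ln (real n / the_inv_into {0..1} \<omega> (1 / real n))"
  proof (cases "\<epsilon> < 1")
    case True
    obtain C where C: "\<forall>\<^sub>F n in sequentially.
      0 \<le> ln (real n / the_inv_into {0..1} \<omega> (1 / real n)) \<and>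
      ln (real n / the_inv_into {0..1} \<omega> (1 / real n)) \<le> (1 + 1 / (1 - \<epsilon>)) * ln (real n) + C"
      using log_bound[of "1 - \<epsilon>"] True \<open>\<epsilon> > 0\<close> by auto
    \<comment> \<open>For \<open>\<alpha> = 1 - \<epsilon>\<close> the coefficient \<open>(1 - \<epsilon>) (1 + 1/\<alpha>)\<close> of \<open>ln n\<close> is \<open>2 - \<epsilon>\<close>.\<close>
    have "\<forall>\<^sub>F n in sequentially. (2 - \<epsilon>) * ln (real n) + (1 - \<epsilon>) * C \<le> ln ((1 + real n / 2)\<^sup>2)"
      using \<open>\<epsilon> > 0\<close> by real_asymp
    with C show ?thesis
    proof eventually_elim
      case (elim n)
      have "(1 - \<epsilon>) * ln (real n / the_inv_into {0..1} \<omega> (1 / real n))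
          \<le> (1 - \<epsilon>) * ((1 + 1 / (1 - \<epsilon>)) * ln (real n) + C)"
        using elim True by (intro mult_left_mono) auto
      also have "\<dots> = (2 - \<epsilon>) * ln (real n) + (1 - \<epsilon>) * C"
        using True by (simp add: field_simps)
      finally show ?case using elim by (simp add: growth_seq_par)
    qed
  next
    case False
    obtain C where "\<forall>\<^sub>F n in sequentially.
      0 \<le> ln (real n / the_inv_into {0..1} \<omega> (1 / real n)) \<and>
      ln (real n / the_inv_into {0..1} \<omega> (1 / real n)) \<le> (1 + 1 / (1/2)) * ln (real n) + C"
      using log_bound[of "1/2"] by auto
    then show ?thesis
    proof eventually_elim
      case (elim n)
      have "(1 - \<epsilon>) * ln (real n / the_inv_into {0..1} \<omega> (1 / real n)) \<le> 0"
        using elim False by (intro mult_nonpos_nonneg) auto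
      also have "0 \<le> ln (growth_seq n par)"
        by (simp add: growth_seq_par)
      finally show ?case .
    qed
  qed
qed

end
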